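(* Let $s,q\in\mathbb{N}$ with $s\le q$ and let $P$ be a $(q,s)$-admissible polynomial. Then there exists a sequence of graphs $G_m$ ($m\in\mathbb{N}$), with $G_m$ of order $m^q$, such that \[ n^+(G_m)=\Theta(m^q),\qquad n^-(G_m)=\Theta(m^s)\qquad\text{as } m\to\infty,\] and $n^0(G_m)=0$ for all sufficiently large $m$.
   Context: Graphs are finite, simple and undirected; the order of a graph is its number of vertices. For a graph $G$ with adjacency matrix $A(G)$, $n^+(G)$, $n^0(G)$, $n^-(G)$ denote the number of positive, zero and negative eigenvalues of $A(G)$, respectively, counted with multiplicity. Here $\mathbb{N}=\{1,2,\dots\}$ and $[q]=\{1,\dots,q\}$. Let $s,q\in\mathbb{N}$ with $s\le q$, and let $P(x_1,\dots,x_q)=\sum_{T\subseteq[q]}c_T\prod_{i\in T}x_i\in\mathbb{Z}[x_1,\dots,x_q]$ be a multilinear integer polynomial. $P$ is called Boolean if $P(x_1,\dots,x_q)\in\{0,1\}$ for all $(x_1,\dots,x_q)\in\{0,1\}^q$. A Boolean polynomial $P$ is called $(q,s)$-admissible if all of the following hold: $P(1,\dots,1)=0$; $c_{[q]}>0$; and $s=\max\{|T|: T\subseteq[q],\ c_T<0\}$. $f(m)=\Theta(g(m))$ as $m\to\infty$ means that there are constants $c,C>0$ (independent of $m$) with $c\,g(m)\le f(m)\le C\,g(m)$ for all sufficiently large $m$. *)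

theory Defs
  imports
    "Graph_Theory.Pair_Digraph"
    "Jordan_Normal_Form.Char_Poly"
    "HOL-Library.Landau_Symbols"
begin

text \<open>
  A finite simple undirected graph is a \<open>pair_graph\<close>: a finite loop-free symmetric digraph,
  an edge \<open>uv\<close> being represented by the two arcs \<open>(u, v)\<close> and \<open>(v, u)\<close>.
  Rows and columns of the adjacency matrix are indexed by the vertices in increasing order;
  any other enumeration gives a permutation-similar matrix, hence the same spectrum.
\<close>

definition adjacency_matrix :: "'a::linorder pair_pre_digraph \<Rightarrow> real mat" where
  "adjacency_matrix G =
     (let vs = sorted_list_of_set (pverts G); n = card (pverts G)
      in mat n n (\<lambda>(i, j). if (vs ! i, vs ! j) \<in> parcs G then 1 else 0))"

text \<open>
  Multiplicity is algebraic. For the real symmetric matrices considered here all eigenvalues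
  are real and algebraic and geometric multiplicities agree.
\<close>

definition eigenvalue_count :: "real mat \<Rightarrow> real set \<Rightarrow> nat" where
  "eigenvalue_count A S = (\<Sum>x | eigenvalue A x \<and> x \<in> S. order x (char_poly A))"

definition n_pos :: "'a::linorder pair_pre_digraph \<Rightarrow> nat" where
  "n_pos G = eigenvalue_count (adjacency_matrix G) {0<..}"

definition n_zero :: "'a::linorder pair_pre_digraph \<Rightarrow> nat" where
  "n_zero G = eigenvalue_count (adjacency_matrix G) {0}"

definition n_neg :: "'a::linorder pair_pre_digraph \<Rightarrow> nat" where
  "n_neg G = eigenvalue_count (adjacency_matrix G) {..<0}"

text \<open>
  A multilinear integer polynomial in \<open>x\<^sub>1, \<dots>, x\<^sub>q\<close> is given by its coefficients \<open>c T\<close>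
  for \<open>T \<subseteq> {1..q}\<close>; the values of \<open>c\<close> on other sets play no role.
\<close>

definition multilinear_eval :: "nat \<Rightarrow> (nat set \<Rightarrow> int) \<Rightarrow> (nat \<Rightarrow> int) \<Rightarrow> int" where
  "multilinear_eval q c x = (\<Sum>T\<in>Pow {1..q}. c T * (\<Prod>i\<in>T. x i))"

definition boolean_polynomial :: "nat \<Rightarrow> (nat set \<Rightarrow> int) \<Rightarrow> bool" where
  "boolean_polynomial q c \<longleftrightarrow>
     (\<forall>x. (\<forall>i\<in>{1..q}. x i \<in> {0, 1}) \<longrightarrow> multilinear_eval q c x \<in> {0, 1})"

text \<open>
  The set under \<open>Max\<close> is nonempty given the preceding conjuncts: the coefficients sum to
  \<open>P(1,\<dots>,1) = 0\<close> and one of them is positive.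
\<close>

definition admissible :: "nat \<Rightarrow> nat \<Rightarrow> (nat set \<Rightarrow> int) \<Rightarrow> bool" where
  "admissible q s c \<longleftrightarrow>
     boolean_polynomial q c \<and>
     multilinear_eval q c (\<lambda>_. 1) = 0 \<and>
     c {1..q} > 0 \<and>
     s = Max {card T | T. T \<subseteq> {1..q} \<and> c T < 0}"

end

theory Submission
  imports Defs
begin

text \<open>
  Take \<open>{0..<m}\<^sup>q\<close> as vertex set and let \<open>u\<close> and \<open>v\<close> be adjacent iff \<open>P(x) = 1\<close>, where \<open>x\<^sub>i\<close> indicates
  whether \<open>u\<close> and \<open>v\<close> agree in coordinate \<open>i\<close>. The adjacency matrix is the sum over \<open>T\<close> of \<open>c\<^sub>T\<close>
  times the tensor product of identity matrices (factors in \<open>T\<close>) and all-ones matrices (other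
  factors). All these summands are diagonalised by the same tensor basis, and for every
  \<open>S \<subseteq> {1..q}\<close> there is a common eigenspace of dimension \<open>(m - 1)\<^bsup>|S|\<^esup>\<close> with eigenvalue
  \<open>\<lambda>\<^sub>S(m)\<close>, the sum of \<open>c\<^sub>T m\<^bsup>q - |T|\<^esup>\<close> over \<open>T \<supseteq> S\<close>. This is a polynomial in \<open>m\<close> with
  constant coefficient \<open>c\<^bsub>[q]\<^esub> > 0\<close>, so it eventually does not vanish; it is positive if
  \<open>|S| > s\<close>, and eventually negative if \<open>|S| = s\<close> and \<open>c\<^sub>S < 0\<close>.
\<close>

section \<open>Eigenvalue counts of diagonalisable matrices\<close>

lemma order_prod_linear:
  fixes d :: "'a \<Rightarrow> real"
  assumes "finite I"
  shows "order x (\<Prod>i\<in>I. [:- d i, 1:]) = card {i\<in>I. d i = x}"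
  using assms
proof (induction I rule: finite_induct)
  case empty
  then show ?case by (simp add: order_0I)
next
  case (insert i I)
  have lin: "order x [:- d i, 1:] = (if d i = x then 1 else 0)"
    using order_power_n_n[of x 1] by (auto intro: order_0I)
  have nz: "(\<Prod>i\<in>I. [:- d i, 1:]) \<noteq> 0"
    using insert.hyps by simp
  have "{j \<in> insert i I. d j = x} = (if d i = x then insert i {j \<in> I. d j = x} else {j \<in> I. d j = x})"
    by auto
  then show ?case
    using insert nz lin by (simp add: order_mult del: mult_pCons_left)
qed

text \<open>Similar matrices share their characteristic polynomial, which here splits into the
  factors \<open>x - d i\<close>. The order of a root is the size of its fibre under
  \<open>d\<close>, so summing orders over distinct eigenvalues counts indices.\<close>

lemma eigenvalue_count_diagonalisable:
  fixes d :: "nat \<Rightarrow> real"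
  assumes sim: "similar_mat A (mat n n (\<lambda>(i, j). if i = j then d i else 0))"
    (is "similar_mat A ?D")
  shows "eigenvalue_count A X = card {i \<in> {..<n}. d i \<in> X}"
proof -
  have "diag_mat ?D = map d [0..<n]"
    by (auto simp: diag_mat_def)
  then have "char_poly ?D = (\<Prod>i\<leftarrow>[0..<n]. [:- d i, 1:])"
    by (subst char_poly_upper_triangular[of _ n])
       (auto simp: upper_triangular_def o_def)
  then have cp: "char_poly A = (\<Prod>i<n. [:- d i, 1:])"
    using char_poly_similar[OF sim]
    by (simp add: prod.distinct_set_conv_list[symmetric] atLeast0LessThan)
  from sim obtain P Q where "similar_mat_wit A ?D P Q"
    unfolding similar_mat_def by blast
  note wit = similar_mat_witD[OF refl this]
  have "dim_row A = n"
    using carrier_matD(1)[OF wit(5)] by simp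
  with wit(4) have A: "A \<in> carrier_mat n n" by simp
  let ?S = "{i \<in> {..<n}. d i \<in> X}"
  have ev: "{x. eigenvalue A x \<and> x \<in> X} = d ` ?S"
    unfolding eigenvalue_root_char_poly[OF A] cp poly_prod by auto
  have "eigenvalue_count A X = (\<Sum>x\<in>d ` ?S. card {i \<in> {..<n}. d i = x})"
    unfolding eigenvalue_count_def ev cp by (simp only: order_prod_linear finite_lessThan)
  also have "\<dots> = (\<Sum>x\<in>d ` ?S. \<Sum>i | i \<in> ?S \<and> d i = x. 1)"
    unfolding card_eq_sum by (intro sum.cong refl) auto
  also have "\<dots> = (\<Sum>i\<in>?S. 1)"
    by (rule sum.group) auto
  finally show ?thesis by simp
qed

section \<open>Tensor products of matrices\<close>

text \<open>
  Column \<open>0\<close> of \<open>basis\<close> is the all-ones vector and column \<open>b > 0\<close> is \<open>e\<^sub>b - e\<^sub>0\<close>. These columns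
  are eigenvectors of the all-ones \<open>m \<times> m\<close> matrix, and \<open>dual m\<close> is the inverse matrix.
\<close>

definition basis :: "nat \<Rightarrow> nat \<Rightarrow> real" where
  "basis a b = (if b = 0 then 1 else of_bool (a = b) - of_bool (a = 0))"

definition dual :: "nat \<Rightarrow> nat \<Rightarrow> nat \<Rightarrow> real" where
  "dual m a b = (if a = 0 then 1 / m else of_bool (a = b) - 1 / m)"

lemma sum_of_bool_mult:
  fixes f :: "nat \<Rightarrow> real"
  assumes "a < m"
  shows "(\<Sum>k<m. of_bool (a = k) * f k) = f a"
proof -
  have "(\<Sum>k<m. of_bool (a = k) * f k) = (\<Sum>k<m. if a = k then f k else 0)"
    by (rule sum.cong) auto
  then show ?thesis using assms by simp
qed

lemma sum_basis:
  assumes "b < m"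
  shows "(\<Sum>k<m. basis k b) = (if b = 0 then m else 0)"
proof (cases "b = 0")
  case False
  have "(\<Sum>k<m. basis k b) = (\<Sum>k<m. of_bool (b = k) * 1 - of_bool (0 = k) * 1)"
    using False by (intro sum.cong) (auto simp: basis_def)
  also have "\<dots> = (\<Sum>k<m. of_bool (b = k) * 1) - (\<Sum>k<m. of_bool (0 = k) * 1)"
    by (rule sum_subtractf)
  also have "\<dots> = 0"
    using assms sum_of_bool_mult[of b m "\<lambda>_. 1"] sum_of_bool_mult[of 0 m "\<lambda>_. 1"] by linarith
  finally show ?thesis using False by simp
qed (simp add: basis_def)

text \<open>Row 0 of the dual takes the average of a vector, and row \<open>a > 0\<close> takes
  entry \<open>a\<close> minus the average. The average is 1 on column 0 of the basis and 0 on every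
  other column.\<close>

lemma dual_basis:
  assumes "a < m" "b < m"
  shows "(\<Sum>k<m. dual m a k * basis k b) = of_bool (a = b)"
proof (cases "a = 0")
  case True
  then have "(\<Sum>k<m. dual m a k * basis k b) = 1 / m * (\<Sum>k<m. basis k b)"
    by (simp add: dual_def sum_divide_distrib)
  then show ?thesis using True assms by (simp add: sum_basis)
next
  case False
  then have "(\<Sum>k<m. dual m a k * basis k b)
      = (\<Sum>k<m. of_bool (a = k) * basis k b) - 1 / m * (\<Sum>k<m. basis k b)"
    by (simp add: dual_def sum_divide_distrib left_diff_distrib sum_subtractf)
  then show ?thesis
    using False assms by (simp add: sum_basis sum_of_bool_mult) (simp add: basis_def)
qed

text \<open>A Kronecker product whose rows and columns are numbered through \<open>h\<close>, since
  matrix indices have to be natural numbers: \<open>h u i\<close> is coordinate \<open>i\<close> of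
  the tuple with number \<open>u\<close>.\<close>

definition tensor_mat ::
    "nat \<Rightarrow> (nat \<Rightarrow> 'i \<Rightarrow> nat) \<Rightarrow> 'i set \<Rightarrow> ('i \<Rightarrow> nat \<Rightarrow> nat \<Rightarrow> real) \<Rightarrow> real mat" where
  "tensor_mat n h I f = mat n n (\<lambda>(u, v). \<Prod>i\<in>I. f i (h u i) (h v i))"

context
  fixes I :: "'i set" and m n :: nat and h :: "nat \<Rightarrow> 'i \<Rightarrow> nat"
  assumes I: "finite I" and h: "bij_betw h {0..<n} (PiE I (\<lambda>_. {..<m}))"
begin

lemma coord_less:
  assumes "u < n" "i \<in> I"
  shows "h u i < m"
proof -
  have "h u \<in> PiE I (\<lambda>_. {..<m})"
    using bij_betwE[OF h] assms(1) by simp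
  then show ?thesis using assms(2) by auto
qed

lemma coord_inj:
  assumes "u < n" "v < n"
  shows "(\<forall>i\<in>I. h u i = h v i) \<longleftrightarrow> u = v"
proof
  assume *: "\<forall>i\<in>I. h u i = h v i"
  have "h u \<in> PiE I (\<lambda>_. {..<m})" "h v \<in> PiE I (\<lambda>_. {..<m})"
    using bij_betwE[OF h] assms by auto
  then have "h u = h v"
    by (rule PiE_ext) (use * in auto)
  then show "u = v"
    using bij_betw_imp_inj_on[OF h] assms by (auto dest: inj_onD)
qed auto

text \<open>Distributivity: expanding the product of sums gives one term for each tuple, and
  \<open>h\<close> enumerates the tuples.\<close>

lemma sum_coord_prod:
  fixes f :: "'i \<Rightarrow> nat \<Rightarrow> real"
  shows "(\<Sum>w = 0..<n. \<Prod>i\<in>I. f i (h w i)) = (\<Prod>i\<in>I. \<Sum>x<m. f i x)"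
proof -
  have "(\<Sum>w = 0..<n. \<Prod>i\<in>I. f i (h w i)) = (\<Sum>g\<in>PiE I (\<lambda>_. {..<m}). \<Prod>i\<in>I. f i (g i))"
    by (rule sum.reindex_bij_betw[OF h])
  also have "\<dots> = (\<Prod>i\<in>I. \<Sum>x<m. f i x)"
    using I by (simp add: prod_sum_PiE)
  finally show ?thesis .
qed

lemma tensor_mat_carrier [simp]: "tensor_mat n h I f \<in> carrier_mat n n"
  by (simp add: tensor_mat_def)

lemma tensor_mat_mult:
  "tensor_mat n h I f * tensor_mat n h I g = tensor_mat n h I (\<lambda>i a b. \<Sum>x<m. f i a x * g i x b)"
proof (rule eq_matI)
  fix u v assume "u < dim_row (tensor_mat n h I (\<lambda>i a b. \<Sum>x<m. f i a x * g i x b))"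
    "v < dim_col (tensor_mat n h I (\<lambda>i a b. \<Sum>x<m. f i a x * g i x b))"
  then have uv: "u < n" "v < n" by (auto simp: tensor_mat_def)
  have "(tensor_mat n h I f * tensor_mat n h I g) $$ (u, v)
      = (\<Sum>w = 0..<n. \<Prod>i\<in>I. f i (h u i) (h w i) * g i (h w i) (h v i))"
    using uv by (simp add: tensor_mat_def scalar_prod_def prod.distrib)
  also have "\<dots> = (\<Prod>i\<in>I. \<Sum>x<m. f i (h u i) x * g i x (h v i))"
    by (rule sum_coord_prod)
  finally show "(tensor_mat n h I f * tensor_mat n h I g) $$ (u, v)
      = tensor_mat n h I (\<lambda>i a b. \<Sum>x<m. f i a x * g i x b) $$ (u, v)"
    using uv by (simp add: tensor_mat_def)
qed (auto simp: tensor_mat_def)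

lemma tensor_dual_basis:
  "tensor_mat n h I (\<lambda>_. dual m) * tensor_mat n h I (\<lambda>_. basis) = 1\<^sub>m n"
proof -
  have "(\<Prod>i\<in>I. of_bool (h u i = h v i)) = (of_bool (u = v) :: real)" if "u < n" "v < n" for u v
    using coord_inj[OF that] I by (auto simp: of_bool_def prod_zero_iff intro: prod.neutral)
  then show ?thesis
    unfolding tensor_mat_mult
    by (intro eq_matI) (auto simp: tensor_mat_def dual_basis coord_less)
qed

text \<open>A coordinate missing from the product over \<open>T\<close> contributes the constant
  factor 1, that is, an all-ones matrix. Its eigenvalue is \<open>m\<close> on basis column 0 and 0
  on the other columns, while the identity factors in \<open>T\<close> have eigenvalue 1. Hence
  every tensor basis column is an eigenvector of all summands at once.\<close>

lemma similar_mat_tensor_sum: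
  fixes a :: "'i set \<Rightarrow> real"
  assumes A: "A = mat n n (\<lambda>(u, v). \<Sum>T\<in>Pow I. a T * (\<Prod>i\<in>T. of_bool (h u i = h v i)))"
  shows "similar_mat A (mat n n (\<lambda>(u, v). if u = v
    then \<Sum>T\<in>Pow I. a T * (\<Prod>i\<in>I - T. if h u i = 0 then real m else 0) else 0))"
proof -
  define d where "d v = (\<Sum>T\<in>Pow I. a T * (\<Prod>i\<in>I - T. if h v i = 0 then real m else 0))" for v
  define D where "D = mat n n (\<lambda>(u, v). if u = v then d u else 0)"
  define Q where "Q = tensor_mat n h I (\<lambda>_. basis)"
  define P where "P = tensor_mat n h I (\<lambda>_. dual m)"
  have carr: "A \<in> carrier_mat n n" "D \<in> carrier_mat n n" "Q \<in> carrier_mat n n" "P \<in> carrier_mat n n"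
    by (auto simp: A D_def Q_def P_def)
  have PQ: "P * Q = 1\<^sub>m n"
    unfolding P_def Q_def by (rule tensor_dual_basis)
  then have QP: "Q * P = 1\<^sub>m n"
    using mat_mult_left_right_inverse carr by blast
  have summand: "(\<Sum>w = 0..<n. (\<Prod>i\<in>T. of_bool (h u i = h w i)) * (\<Prod>i\<in>I. basis (h w i) (h v i)))
      = (\<Prod>i\<in>I. basis (h u i) (h v i)) * (\<Prod>i\<in>I - T. if h v i = 0 then real m else 0)"
    if T: "T \<subseteq> I" and uv: "u < n" "v < n" for T u v
  proof -
    \<comment> \<open>Padding with the entries of the all-ones matrix turns the product over
      \<open>T\<close> into one over \<open>I\<close>, so that the sum over \<open>w\<close>
      factorises.\<close>
    let ?e = "\<lambda>i x. (if i \<in> T then of_bool (h u i = x) else 1) :: real"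
    have "(\<Prod>i\<in>T. of_bool (h u i = h w i)) = (\<Prod>i\<in>I. ?e i (h w i))" for w
      using T I by (simp add: prod.If_cases Int_absorb1)
    then have "(\<Sum>w = 0..<n. (\<Prod>i\<in>T. of_bool (h u i = h w i)) * (\<Prod>i\<in>I. basis (h w i) (h v i)))
        = (\<Sum>w = 0..<n. \<Prod>i\<in>I. ?e i (h w i) * basis (h w i) (h v i))"
      by (simp add: prod.distrib)
    also have "\<dots> = (\<Prod>i\<in>I. \<Sum>x<m. ?e i x * basis x (h v i))"
      by (rule sum_coord_prod)
    also have "\<dots> = (\<Prod>i\<in>I. basis (h u i) (h v i) *
        (if i \<in> T then 1 else if h v i = 0 then real m else 0))"
    proof (rule prod.cong)
      fix i assume "i \<in> I"
      then have "h u i < m" "h v i < m" using uv coord_less by auto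
      \<comment> \<open>Off \<open>T\<close> the column sum vanishes unless
        \<open>h v i = 0\<close>, and column 0 has all entries 1, so the factor
        \<open>basis (h u i) (h v i)\<close> can be split off in every case.\<close>
      then show "(\<Sum>x<m. ?e i x * basis x (h v i))
          = basis (h u i) (h v i) * (if i \<in> T then 1 else if h v i = 0 then real m else 0)"
        by (auto simp: sum_of_bool_mult sum_basis) (simp add: basis_def)
    qed simp
    also have "\<dots> = (\<Prod>i\<in>I. basis (h u i) (h v i)) *
        (\<Prod>i\<in>I - T. if h v i = 0 then real m else 0)"
      using I by (simp add: prod.distrib prod.If_cases Diff_eq)
    finally show ?thesis .
  qed
  have "A * Q = Q * D"
  proof (rule eq_matI)
    fix u v assume "u < dim_row (Q * D)" "v < dim_col (Q * D)"
    then have uv: "u < n" "v < n" using carr by auto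
    have "(A * Q) $$ (u, v) = (\<Sum>w = 0..<n. \<Sum>T\<in>Pow I. a T *
        ((\<Prod>i\<in>T. of_bool (h u i = h w i)) * (\<Prod>i\<in>I. basis (h w i) (h v i))))"
      using uv by (simp add: A Q_def tensor_mat_def scalar_prod_def sum_distrib_right mult.assoc)
    also have "\<dots> = (\<Sum>T\<in>Pow I. a T * (\<Sum>w = 0..<n.
        (\<Prod>i\<in>T. of_bool (h u i = h w i)) * (\<Prod>i\<in>I. basis (h w i) (h v i))))"
      by (subst sum.swap) (simp add: sum_distrib_left)
    also have "\<dots> = (\<Sum>T\<in>Pow I. a T * ((\<Prod>i\<in>I. basis (h u i) (h v i)) *
        (\<Prod>i\<in>I - T. if h v i = 0 then real m else 0)))"
      using uv by (intro sum.cong refl) (simp add: summand)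
    also have "\<dots> = (\<Prod>i\<in>I. basis (h u i) (h v i)) * d v"
      by (simp add: d_def sum_distrib_left mult_ac)
    also have "\<dots> = (\<Sum>w = 0..<n. if w = v then (\<Prod>i\<in>I. basis (h u i) (h w i)) * d w else 0)"
      using uv by simp
    also have "\<dots> = (\<Sum>w = 0..<n. (\<Prod>i\<in>I. basis (h u i) (h w i)) * (if w = v then d w else 0))"
      by (intro sum.cong) auto
    also have "\<dots> = (Q * D) $$ (u, v)"
      using uv by (simp add: Q_def D_def tensor_mat_def scalar_prod_def)
    finally show "(A * Q) $$ (u, v) = (Q * D) $$ (u, v)" .
  qed (use carr in auto)
  then have "A = Q * D * P"
    using carr QP by (metis assoc_mult_mat right_mult_one_mat)
  then have "similar_mat A D"
    using carr PQ QP by (intro similar_matI[of _ _ Q P n]) auto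
  then show ?thesis
    unfolding D_def d_def .
qed

end

section \<open>The spectrum of the graph\<close>

definition eigen_poly :: "nat \<Rightarrow> (nat set \<Rightarrow> int) \<Rightarrow> nat set \<Rightarrow> real poly" where
  "eigen_poly q c S = (\<Sum>T | T \<subseteq> {1..q} \<and> S \<subseteq> T. monom (of_int (c T)) (q - card T))"

lemma poly_eigen_poly:
  "poly (eigen_poly q c S) x = (\<Sum>T | T \<subseteq> {1..q} \<and> S \<subseteq> T. of_int (c T) * x ^ (q - card T))"
  by (simp add: eigen_poly_def poly_sum poly_monom)

lemma coeff_eigen_poly:
  assumes "k \<le> q"
  shows "coeff (eigen_poly q c S) (q - k)
    = (\<Sum>T | T \<subseteq> {1..q} \<and> S \<subseteq> T \<and> card T = k. of_int (c T))"
proof -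
  \<comment> \<open>Truncated subtraction from \<open>q\<close> is injective on numbers up to
    \<open>q\<close>, so the exponent determines \<open>card T\<close>.\<close>
  have "q - card T = q - k \<longleftrightarrow> card T = k" if "T \<subseteq> {1..q}" for T
    using card_mono[OF _ that] assms by auto
  then have "coeff (eigen_poly q c S) (q - k)
      = (\<Sum>T | T \<subseteq> {1..q} \<and> S \<subseteq> T. if card T = k then of_int (c T) else 0)"
    unfolding eigen_poly_def coeff_sum by (intro sum.cong) (auto simp: coeff_monom)
  also have "\<dots> = (\<Sum>T | T \<subseteq> {1..q} \<and> S \<subseteq> T \<and> card T = k. of_int (c T))"
    by (subst sum.inter_filter[symmetric]) (auto intro!: sum.cong finite_subset[of _ "Pow {1..q}"])
  finally show ?thesis .
qed

lemma subsets_full_card: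
  assumes "S \<subseteq> T" "finite T"
  shows "{U. U \<subseteq> T \<and> S \<subseteq> U \<and> card U = card S} = {S}"
proof -
  have "U = S" if "U \<subseteq> T" "S \<subseteq> U" "card U = card S" for U
    using that assms by (metis card_subset_eq finite_subset)
  then show ?thesis using assms by auto
qed

lemma coeff_eigen_poly_top:
  assumes "S \<subseteq> {1..q}"
  shows "coeff (eigen_poly q c S) (q - card S) = of_int (c S)"
proof -
  have "card S \<le> q" using card_mono[OF _ assms] by simp
  then show ?thesis
    using assms by (simp add: coeff_eigen_poly subsets_full_card)
qed

text \<open>Exponent 0 arises only from the full set, which contains every \<open>S\<close>. For
  admissible \<open>c\<close> this value is positive, so no eigenvalue polynomial is zero.\<close>

lemma coeff_eigen_poly_0:
  assumes "S \<subseteq> {1..q}"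
  shows "coeff (eigen_poly q c S) 0 = of_int (c {1..q})"
proof -
  have "T = {1..q}" if "T \<subseteq> {1..q}" "card T = q" for T
    using that by (intro card_subset_eq) auto
  then have "{T. T \<subseteq> {1..q} \<and> S \<subseteq> T \<and> card T = q} = {{1..q}}"
    using assms by auto
  then show ?thesis
    using coeff_eigen_poly[of q q c S] by simp
qed

lemma degree_eigen_poly: "degree (eigen_poly q c S) \<le> q - card S"
  unfolding eigen_poly_def
proof (intro degree_sum_le)
  fix T assume "T \<in> {T. T \<subseteq> {1..q} \<and> S \<subseteq> T}"
  then have "card S \<le> card T"
    by (auto intro!: card_mono finite_subset[of T])
  then have "q - card T \<le> q - card S" by simp
  then show "degree (monom (real_of_int (c T)) (q - card T)) \<le> q - card S"
    by (rule order.trans[OF degree_monom_le])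
qed (auto intro: finite_subset[of _ "Pow {1..q}"])

text \<open>The negated polynomial has positive leading coefficient and eventually stays above
  it.\<close>

lemma eventually_poly_neg:
  fixes p :: "real poly"
  assumes "lead_coeff p < 0"
  shows "\<forall>\<^sub>F m in sequentially. poly p (real m) < 0"
proof -
  obtain N where N: "\<And>x. x \<ge> N \<Longrightarrow> poly (- p) x \<ge> lead_coeff (- p)"
    using poly_pinfty_gt_lc[of "- p"] assms by auto
  have "\<forall>\<^sub>F m in sequentially. real m \<ge> N"
    using filterlim_real_sequentially by (simp add: filterlim_at_top)
  then show ?thesis
  proof eventually_elim
    case (elim m)
    then show ?case using N[of "real m"] assms by simp
  qed
qed

lemma eventually_poly_nonzero:
  fixes p :: "real poly"
  assumes "p \<noteq> 0"
  shows "\<forall>\<^sub>F m in sequentially. poly p (real m) \<noteq> 0"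
proof -
  have "finite (real -` {x. poly p x = 0})"
    using poly_roots_finite[OF assms] by (rule finite_vimageI) (simp add: inj_on_def)
  then have "\<forall>\<^sub>F m in cofinite. poly p (real m) \<noteq> 0"
    by (simp add: eventually_cofinite vimage_def)
  then show ?thesis by (simp add: cofinite_eq_sequentially)
qed

section \<open>The graph and its eigenvalue multiplicities\<close>

definition agreement_graph ::
    "nat \<Rightarrow> (nat set \<Rightarrow> int) \<Rightarrow> (nat \<Rightarrow> nat \<Rightarrow> nat) \<Rightarrow> nat \<Rightarrow> nat pair_pre_digraph" where
  "agreement_graph q c h n = \<lparr>pverts = {0..<n},
     parcs = {(u, v). u < n \<and> v < n \<and> multilinear_eval q c (\<lambda>i. of_bool (h u i = h v i)) = 1}\<rparr>"

text \<open>There are no loops because a vertex agrees with itself in all coordinates and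
  \<open>P(1,...,1) = 0\<close>; agreement is symmetric in the two vertices.\<close>

lemma pair_graph_agreement_graph:
  assumes "multilinear_eval q c (\<lambda>_. 1) = 0"
  shows "pair_graph (agreement_graph q c h n)"
proof
  show "finite (parcs (agreement_graph q c h n))"
    by (rule finite_subset[of _ "{0..<n} \<times> {0..<n}"]) (auto simp: agreement_graph_def)
  show "symmetric (with_proj (agreement_graph q c h n))"
  proof -
    have "(\<lambda>i. of_bool (h u i = h v i)) = (\<lambda>i. of_bool (h v i = h u i))" for u v
      by auto
    then have "multilinear_eval q c (\<lambda>i. of_bool (h u i = h v i))
        = multilinear_eval q c (\<lambda>i. of_bool (h v i = h u i))" for u v
      by metis
    then show ?thesis
      unfolding symmetric_def arcs_ends_conv agreement_graph_def by (auto intro!: symI)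
  qed
  show "fst e \<noteq> snd e" if "e \<in> parcs (agreement_graph q c h n)" for e
    using that assms by (auto simp: agreement_graph_def)
qed (auto simp: agreement_graph_def)

lemma card_Collect_bij_betw:
  assumes "bij_betw h A B"
  shows "card {x \<in> A. P (h x)} = card {y \<in> B. P y}"
proof (rule bij_betw_same_card)
  show "bij_betw h {x \<in> A. P (h x)} {y \<in> B. P y}"
    using assms unfolding bij_betw_def inj_on_def by auto
qed

text \<open>Each coordinate in \<open>S\<close> has \<open>m - 1\<close> nonzero choices and every
  other one is forced to be 0, a legal entry because \<open>1 \<le> m\<close>.\<close>

lemma card_support_eq:
  assumes "S \<subseteq> I" "finite I" "1 \<le> m"
  shows "card {g \<in> PiE I (\<lambda>_. {..<m}). {i\<in>I. g i \<noteq> 0} = S} = (m - 1) ^ card S"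
proof -
  have supp: "{i\<in>I. g i \<noteq> 0} = S \<longleftrightarrow> (\<forall>i\<in>I. i \<in> S \<longleftrightarrow> g i \<noteq> 0)" for g :: "'a \<Rightarrow> nat"
    using assms(1) by blast
  have entry: "x \<in> (if i \<in> S then {1..<m} else {0}) \<longleftrightarrow> x < m \<and> (i \<in> S \<longleftrightarrow> x \<noteq> 0)" for i x
    using assms(3) by auto
  have "{g \<in> PiE I (\<lambda>_. {..<m}). {i\<in>I. g i \<noteq> 0} = S}
      = PiE I (\<lambda>i. if i \<in> S then {1..<m} else {0})"
    by (rule Set.set_eqI) (simp only: mem_Collect_eq PiE_iff lessThan_iff supp entry, blast)
  also have "card \<dots> = (\<Prod>i\<in>I. card (if i \<in> S then {1..<m} else {0::nat}))"
    using assms by (intro card_PiE)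
  also have "\<dots> = (\<Prod>i\<in>I. if i \<in> S then m - 1 else 1)"
    by (intro prod.cong) auto
  also have "\<dots> = (m - 1) ^ card S"
    using assms by (simp add: prod.If_cases Int_absorb1)
  finally show ?thesis .
qed

lemma eigenvalue_count_agreement_graph:
  assumes bool: "boolean_polynomial q c" and m: "1 \<le> m"
    and h: "bij_betw h {0..<n} (PiE {1..q} (\<lambda>_. {..<m}))"
  shows "eigenvalue_count (adjacency_matrix (agreement_graph q c h n)) X
    = (\<Sum>S | S \<subseteq> {1..q} \<and> poly (eigen_poly q c S) (real m) \<in> X. (m - 1) ^ card S)"
proof -
  let ?A = "adjacency_matrix (agreement_graph q c h n)"
  let ?d = "\<lambda>g. \<Sum>T\<in>Pow {1..q}. of_int (c T) * (\<Prod>i\<in>{1..q} - T. if g i = 0 then real m else 0)"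
  let ?supp = "\<lambda>g. {i\<in>{1..q}. g i \<noteq> (0::nat)}"
  let ?F = "PiE {1..q} (\<lambda>_. {..<m})"
  have F: "finite ?F" by (intro finite_PiE) auto
  \<comment> \<open>The eigenvalue depends only on the support of the tuple: the product off
    \<open>T\<close> is a power of \<open>m\<close> if \<open>T\<close> contains the support, and
    has a zero factor otherwise.\<close>
  have eigen: "?d g = poly (eigen_poly q c (?supp g)) (real m)" for g
  proof -
    have "(\<Prod>i\<in>{1..q} - T. if g i = 0 then real m else 0)
        = (if ?supp g \<subseteq> T then real m ^ (q - card T) else 0)" if "T \<subseteq> {1..q}" for T
    proof (cases "?supp g \<subseteq> T")
      case True
      then have "(\<Prod>i\<in>{1..q} - T. if g i = 0 then real m else 0) = (\<Prod>i\<in>{1..q} - T. real m)"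
        by (intro prod.cong) auto
      also have "\<dots> = real m ^ (q - card T)"
        using that by (simp add: card_Diff_subset finite_subset)
      finally show ?thesis using True by simp
    next
      case False
      then obtain i where "i \<in> {1..q} - T" "g i \<noteq> 0" by blast
      then have "(\<Prod>i\<in>{1..q} - T. if g i = 0 then real m else 0) = 0"
        by (intro prod_zero bexI[of _ i]) auto
      then show ?thesis using False by simp
    qed
    then have "?d g = (\<Sum>T\<in>Pow {1..q}. if ?supp g \<subseteq> T then of_int (c T) * real m ^ (q - card T) else 0)"
      by (intro sum.cong) auto
    also have "\<dots> = poly (eigen_poly q c (?supp g)) (real m)"
      unfolding poly_eigen_poly by (subst sum.inter_filter[symmetric]) (auto intro!: sum.cong)
    finally show ?thesis .
  qed
  \<comment> \<open>Booleanness makes the 0/1 adjacency entry equal to the value of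
    \<open>P\<close>, which is a linear combination of tensor products.\<close>
  have "(if multilinear_eval q c (\<lambda>i. of_bool (h u i = h v i)) = 1 then 1 else 0)
      = (\<Sum>T\<in>Pow {1..q}. real_of_int (c T) * (\<Prod>i\<in>T. of_bool (h u i = h v i)))" for u v
  proof -
    have "multilinear_eval q c (\<lambda>i. of_bool (h u i = h v i)) \<in> {0, 1}"
      using bool unfolding boolean_polynomial_def by (simp add: of_bool_def)
    then have "(if multilinear_eval q c (\<lambda>i. of_bool (h u i = h v i)) = 1 then 1 else 0)
        = real_of_int (multilinear_eval q c (\<lambda>i. of_bool (h u i = h v i)))"
      by auto
    then show ?thesis by (simp add: multilinear_eval_def)
  qed
  then have "?A = mat n n (\<lambda>(u, v). \<Sum>T\<in>Pow {1..q}. real_of_int (c T) *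
      (\<Prod>i\<in>T. of_bool (h u i = h v i)))"
    by (intro eq_matI) (auto simp: adjacency_matrix_def agreement_graph_def Let_def)
  then have "similar_mat ?A (mat n n (\<lambda>(u, v). if u = v then ?d (h u) else 0))"
    by (intro similar_mat_tensor_sum[OF _ h]) auto
  then have "eigenvalue_count ?A X = card {u \<in> {..<n}. ?d (h u) \<in> X}"
    by (rule eigenvalue_count_diagonalisable)
  also have "\<dots> = card {g \<in> ?F. ?d g \<in> X}"
    using card_Collect_bij_betw[OF h, of "\<lambda>g. ?d g \<in> X"] unfolding atLeast0LessThan .
  also have "\<dots> = card {g \<in> ?F. poly (eigen_poly q c (?supp g)) (real m) \<in> X}"
    by (simp only: eigen)
  \<comment> \<open>The tuples are split into disjoint classes by their support.\<close>
  also have "\<dots> = card (\<Union>S\<in>{S. S \<subseteq> {1..q} \<and> poly (eigen_poly q c S) (real m) \<in> X}. {g \<in> ?F. ?supp g = S})"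
    by (rule arg_cong[where f = card]) auto
  also have "\<dots> = (\<Sum>S | S \<subseteq> {1..q} \<and> poly (eigen_poly q c S) (real m) \<in> X.
      card {g \<in> ?F. ?supp g = S})"
    using F by (intro card_UN_disjoint) (auto intro: finite_subset[of _ "Pow {1..q}"])
  also have "\<dots> = (\<Sum>S | S \<subseteq> {1..q} \<and> poly (eigen_poly q c S) (real m) \<in> X. (m - 1) ^ card S)"
    using m by (intro sum.cong refl card_support_eq) auto
  finally show ?thesis .
qed

section \<open>Growth rates and consequences of admissibility\<close>

lemma bigtheta_sum_powers:
  fixes \<F> :: "nat \<Rightarrow> 'a set set"
  assumes I: "finite I"
    and count: "\<forall>\<^sub>F m in sequentially. N m = (\<Sum>S\<in>\<F> m. (m - 1) ^ card S)"
    and \<F>: "\<forall>\<^sub>F m in sequentially. \<F> m \<subseteq> Pow I \<and> (\<forall>S\<in>\<F> m. card S \<le> k)"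
    and S\<^sub>0: "\<forall>\<^sub>F m in sequentially. S\<^sub>0 \<in> \<F> m" "card S\<^sub>0 = k"
  shows "(\<lambda>m. real (N m)) \<in> \<Theta>[sequentially](\<lambda>m. real (m ^ k))"
\<comment> \<open>The lower constant comes from the single term for \<open>S\<^sub>0\<close> and
  \<open>m \<le> 2 * (m - 1)\<close> for \<open>m \<ge> 2\<close>; the upper one bounds the number
  of sets by \<open>2 ^ card I\<close>.\<close>
proof (rule bigthetaI'[of "1 / 2 ^ k" "2 ^ card I"])
  show "\<forall>\<^sub>F m in sequentially. 1 / 2 ^ k * norm (real (m ^ k)) \<le> norm (real (N m)) \<and>
      norm (real (N m)) \<le> 2 ^ card I * norm (real (m ^ k))"
    using count \<F> S\<^sub>0(1) eventually_ge_at_top[of 2]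
  proof eventually_elim
    case (elim m)
    have fin: "finite (\<F> m)" using elim I by (auto intro: finite_subset)
    have "(m - 1) ^ k \<le> N m"
      using elim member_le_sum[of S\<^sub>0 "\<F> m" "\<lambda>S. (m - 1) ^ card S"] fin S\<^sub>0(2) by simp
    moreover have "m ^ k \<le> 2 ^ k * (m - 1) ^ k"
      using elim power_mono[of m "2 * (m - 1)" k] by (simp add: power_mult_distrib)
    ultimately have "m ^ k \<le> 2 ^ k * N m"
      by (meson mult_le_mono2 order.trans)
    then have lower: "real (m ^ k) \<le> 2 ^ k * real (N m)"
      by (metis of_nat_le_iff of_nat_mult of_nat_numeral of_nat_power)
    have "(m - 1) ^ card S \<le> m ^ k" if "S \<in> \<F> m" for S
    proof -
      have "(m - 1) ^ card S \<le> m ^ card S" by (simp add: power_mono)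
      also have "\<dots> \<le> m ^ k" using that elim by (intro power_increasing) auto
      finally show ?thesis .
    qed
    then have "N m \<le> card (\<F> m) * m ^ k"
      using elim sum_bounded_above[of "\<F> m" "\<lambda>S. (m - 1) ^ card S" "m ^ k"] by simp
    also have "\<dots> \<le> 2 ^ card I * m ^ k"
      using card_mono[of "Pow I" "\<F> m"] elim I by (simp add: card_Pow)
    finally have "real (N m) \<le> 2 ^ card I * real (m ^ k)"
      by (metis of_nat_le_iff of_nat_mult of_nat_numeral of_nat_power)
    with lower show ?case by (simp add: field_simps)
  qed
qed auto

lemma admissibleD:
  assumes "admissible q s c"
  shows "boolean_polynomial q c" "multilinear_eval q c (\<lambda>_. 1) = 0" "c {1..q} > 0"
    and "\<exists>T \<subseteq> {1..q}. c T < 0 \<and> card T = s"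
    and "\<And>T. T \<subseteq> {1..q} \<Longrightarrow> c T < 0 \<Longrightarrow> card T \<le> s"
proof -
  let ?M = "{card T | T. T \<subseteq> {1..q} \<and> c T < 0}"
  show zero: "multilinear_eval q c (\<lambda>_. 1) = 0" and pos: "c {1..q} > 0"
    and "boolean_polynomial q c"
    using assms by (auto simp: admissible_def)
  have s: "s = Max ?M" using assms by (simp add: admissible_def)
  have fin: "finite ?M"
    by (rule finite_subset[of _ "card ` Pow {1..q}"]) auto
  have "\<exists>T\<subseteq>{1..q}. c T < 0"
  proof (rule ccontr)
    assume "\<not> ?thesis"
    then have nn: "c T \<ge> 0" if "T \<in> Pow {1..q}" for T
      using that by (meson PowD not_le)
    have "c {1..q} \<le> (\<Sum>T\<in>Pow {1..q}. c T)"
      by (rule member_le_sum) (use nn in auto)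
    then show False using zero pos by (simp add: multilinear_eval_def)
  qed
  then have "?M \<noteq> {}" by auto
  then have "s \<in> ?M" unfolding s by (intro Max_in fin)
  then show "\<exists>T \<subseteq> {1..q}. c T < 0 \<and> card T = s" by auto
  show "card T \<le> s" if "T \<subseteq> {1..q}" "c T < 0" for T
    unfolding s using that by (intro Max_ge fin) auto
qed

text \<open>By maximality of \<open>s\<close> no superset of \<open>S\<close> has a negative
  coefficient, so all summands are nonnegative. The full set contributes \<open>c {1..q} > 0\<close>
  with exponent 0, which is positive even at \<open>x = 0\<close>.\<close>

lemma eigen_poly_pos:
  assumes adm: "admissible q s c" and S: "S \<subseteq> {1..q}" "card S > s" and "0 \<le> x"
  shows "poly (eigen_poly q c S) x > 0"
proof -
  have nn: "c T \<ge> 0" if "T \<subseteq> {1..q}" "S \<subseteq> T" for T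
  proof (rule ccontr)
    assume "\<not> c T \<ge> 0"
    then have "card T \<le> s" using admissibleD(5)[OF adm] that by simp
    moreover have "card S \<le> card T"
      using that by (auto intro!: card_mono finite_subset[of T])
    ultimately show False using S by simp
  qed
  have "0 < real_of_int (c {1..q}) * x ^ (q - card {1..q})"
    using admissibleD(3)[OF adm] by simp
  also have "\<dots> \<le> (\<Sum>T | T \<subseteq> {1..q} \<and> S \<subseteq> T. of_int (c T) * x ^ (q - card T))"
    by (rule member_le_sum[where f = "\<lambda>T. of_int (c T) * x ^ (q - card T)"])
       (use S nn assms(4) in \<open>auto intro: finite_subset[of _ "Pow {1..q}"]\<close>)
  finally show ?thesis by (simp add: poly_eigen_poly)
qed

theorem theorem3p1:
  fixes s q :: nat and c :: "nat set \<Rightarrow> int"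
  assumes "1 \<le> s" and "s \<le> q"
    and "admissible q s c"
  shows "\<exists>G :: nat \<Rightarrow> nat pair_pre_digraph.
    (\<forall>m\<ge>1. pair_graph (G m) \<and> card (pverts (G m)) = m ^ q) \<and>
    (\<lambda>m. real (n_pos (G m))) \<in> \<Theta>[sequentially](\<lambda>m. real (m ^ q)) \<and>
    (\<lambda>m. real (n_neg (G m))) \<in> \<Theta>[sequentially](\<lambda>m. real (m ^ s)) \<and>
    (\<forall>\<^sub>F m in sequentially. n_zero (G m) = 0)"
proof -
  note adm = admissibleD[OF assms(3)]
  have "\<forall>m::nat. \<exists>h. bij_betw h {0..<m ^ q} (PiE {1..q} (\<lambda>_. {..<m}))"
  proof
    fix m :: nat
    have "finite (PiE {1..q} (\<lambda>_. {..<m}))" by (intro finite_PiE) auto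
    from ex_bij_betw_nat_finite[OF this] show "\<exists>h. bij_betw h {0..<m ^ q} (PiE {1..q} (\<lambda>_. {..<m}))"
      by (simp add: card_PiE)
  qed
  from choice[OF this]
  obtain h where h: "\<And>m::nat. bij_betw (h m) {0..<m ^ q} (PiE {1..q} (\<lambda>_. {..<m}))"
    by blast
  define G where "G m = agreement_graph q c (h m) (m ^ q)" for m
  \<comment> \<open>The supports whose eigenvalue lies in \<open>X\<close>; the three inertia
    indices are sums of \<open>(m - 1) ^ card S\<close> over such families.\<close>
  define \<F> where "\<F> X m = {S. S \<subseteq> {1..q} \<and> poly (eigen_poly q c S) (real m) \<in> X}"
    for X and m :: nat
  have count: "\<forall>\<^sub>F m in sequentially.
      eigenvalue_count (adjacency_matrix (G m)) X = (\<Sum>S\<in>\<F> X m. (m - 1) ^ card S)" for X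
    using eventually_ge_at_top[of 1]
    by eventually_elim (simp only: G_def \<F>_def eigenvalue_count_agreement_graph[OF adm(1) _ h])
  have sub: "\<F> X m \<subseteq> Pow {1..q}" for X m
    by (auto simp: \<F>_def)
  have card_le: "card S \<le> q" if "S \<in> \<F> X m" for S X m
    using card_mono[of "{1..q}" S] that by (auto simp: \<F>_def)
  obtain S\<^sub>0 where S\<^sub>0: "S\<^sub>0 \<subseteq> {1..q}" "c S\<^sub>0 < 0" "card S\<^sub>0 = s"
    using adm(4) by auto
  \<comment> \<open>The only subset of size \<open>q\<close> is the full one, whose coefficient is
    positive.\<close>
  have "s \<noteq> q"
    using S\<^sub>0 adm(3) card_subset_eq[of "{1..q}" S\<^sub>0] by auto
  then have "card {1..q} > s" using assms(2) by simp
  then have "{1..q} \<in> \<F> {0<..} m" for m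
    using eigen_poly_pos[OF assms(3), of "{1..q}"] by (simp add: \<F>_def)
  then have pos: "(\<lambda>m. real (n_pos (G m))) \<in> \<Theta>[sequentially](\<lambda>m. real (m ^ q))"
    unfolding n_pos_def using sub card_le
    by (intro bigtheta_sum_powers[OF _ count, of "{1..q}" _ _ "{1..q}"]) auto
  \<comment> \<open>The coefficient at the degree bound is \<open>c S\<^sub>0 < 0\<close>, so the
    bound is attained and the leading coefficient is negative.\<close>
  have "degree (eigen_poly q c S\<^sub>0) = q - card S\<^sub>0"
    using coeff_eigen_poly_top[OF S\<^sub>0(1)] S\<^sub>0(2) degree_eigen_poly[of q c S\<^sub>0]
    by (intro antisym le_degree) auto
  then have "lead_coeff (eigen_poly q c S\<^sub>0) < 0"
    using coeff_eigen_poly_top[OF S\<^sub>0(1)] S\<^sub>0(2) by simp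
  then have "\<forall>\<^sub>F m in sequentially. S\<^sub>0 \<in> \<F> {..<0} m"
    using eventually_poly_neg S\<^sub>0(1) by (simp add: \<F>_def)
  moreover have "card S \<le> s" if "S \<in> \<F> {..<0} m" for S m
    using eigen_poly_pos[OF assms(3), of S "real m"] that by (force simp: \<F>_def)
  ultimately have neg: "(\<lambda>m. real (n_neg (G m))) \<in> \<Theta>[sequentially](\<lambda>m. real (m ^ s))"
    unfolding n_neg_def using sub S\<^sub>0(3)
    by (intro bigtheta_sum_powers[OF _ count, of "{1..q}" _ _ S\<^sub>0]) auto
  have "eigen_poly q c S \<noteq> 0" if "S \<in> Pow {1..q}" for S
    using coeff_eigen_poly_0[of S q c] that adm(3) by auto
  \<comment> \<open>Only finitely many polynomials occur, so all of them are nonzero at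
    \<open>m\<close> from some point on.\<close>
  then have "\<forall>\<^sub>F m in sequentially. \<forall>S\<in>Pow {1..q}. poly (eigen_poly q c S) (real m) \<noteq> 0"
    by (intro eventually_ball_finite ballI eventually_poly_nonzero) auto
  then have zero: "\<forall>\<^sub>F m in sequentially. n_zero (G m) = 0"
    unfolding n_zero_def using count[of "{0}"]
  proof eventually_elim
    case (elim m)
    then have "\<F> {0} m = {}" by (auto simp: \<F>_def)
    with elim show ?case by simp
  qed
  have "pair_graph (G m) \<and> card (pverts (G m)) = m ^ q" for m
    using pair_graph_agreement_graph[OF adm(2)] by (simp add: G_def) (simp add: agreement_graph_def)
  with pos neg zero show ?thesis by blast
qed

end
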